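(* (Stability) In the off-policy setting described in the context, assume that the Markov chain induced by $\mu$ is ergodic, that $\pi(a|s)>0$ implies $\mu(a|s)>0$ for all $(s,a)$, and that the feature matrix $\boldsymbol\Phi$ has full column rank. Let $\mathbf A=\boldsymbol\Phi^\top\mathbf D_\mu^\theta(\mathbf I-(\mathbf P_\pi\boldsymbol\Gamma)^n)\boldsymbol\Phi$. Then there exists a constant $\eta_0>0$ such that $$\|\mathbf D_\mu^\epsilon\|<\eta_0\ \Longrightarrow\ \mathbf A\text{ is positive definite.}$$
   Context: **MDP.** $\mathcal S$ and $\mathcal A$ are finite state and action sets, $P(s'|s,a)$ is the transition probability, $\gamma:\mathcal S\to[0,1]$ is a state-dependent discount, and $n\ge 1$ is a fixed integer. The target policy $\pi(a|s)$ and behavior policy $\mu(a|s)$ are fixed. Ergodic means irreducible and aperiodic; $d_\mu$ is the stationary distribution of the chain on $\mathcal S$ induced by $\mu$. **Followon trace.** Along a trajectory with $A_t\sim\mu(\cdot|S_t)$, $S_{t+1}\sim P(\cdot|S_t,A_t)$, write $\rho_t=\pi(A_t|S_t)/\mu(A_t|S_t)$, $\gamma_t=\gamma(S_t)$, and set $F_0=\dots=F_{n-1}=1$, $F_t=\big(\prod_{i=t-n}^{t-1}\rho_i\gamma_{i+1}\big)F_{t-n}+1$ for $t\ge n$. It is a standing assumption that the (finite) limit $f(s)=\lim_{t\to\infty}\mathbb E_\mu[F_t\mid S_t=s]$ exists for every $s$. **Trace model and matrices.** $f_\theta:\mathcal S\to\mathbb R$ is a function with a fixed parameter $\theta$, approximating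 $f$. $\mathbf D_\mu^\theta$, $\mathbf D_\mu^f$ are the diagonal matrices with diagonal entries $d_\mu(s)f_\theta(s)$ and $d_\mu(s)f(s)$ respectively, and $\mathbf D_\mu^\epsilon=\mathbf D_\mu^\theta-\mathbf D_\mu^f$. $\mathbf P_\pi(s,s')=\sum_a\pi(a|s)P(s'|s,a)$, $\boldsymbol\Gamma=\mathrm{diag}(\gamma)$. $\boldsymbol\phi(s)\in\mathbb R^K$ is the feature vector of $s$ and $\boldsymbol\Phi$ is the matrix whose $s$-th row is $\boldsymbol\phi(s)^\top$. $\|\cdot\|$ is the matrix norm induced by the Euclidean norm. A real square matrix $\mathbf A$, not necessarily symmetric, is positive definite if $x^\top\mathbf A x>0$ for every nonzero real vector $x$. The constant $\eta_0$ does not depend on $f_\theta$. *)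

theory Defs
  imports "HOL-Probability.Probability"
begin

section \<open>Matrices\<close>

definition diag_mat :: "('s \<Rightarrow> real) \<Rightarrow> real ^ 's ^ 's" where
  "diag_mat v = (\<chi> i j. if i = j then v i else 0)"

text \<open>Powers with respect to the matrix product; the library's \<open>^\<close> on \<open>real ^ 's ^ 's\<close> is the
  componentwise power.\<close>

primrec mat_pow :: "real ^ 's ^ 's \<Rightarrow> nat \<Rightarrow> real ^ 's ^ 's" where
  "mat_pow A 0 = mat 1"
| "mat_pow A (Suc m) = A ** mat_pow A m"

definition op_norm :: "real ^ 'm ^ 'n \<Rightarrow> real" where
  "op_norm A = onorm (\<lambda>x. A *v x)"

definition pos_def :: "real ^ 'k ^ 'k \<Rightarrow> bool" where
  "pos_def A \<longleftrightarrow> (\<forall>x. x \<noteq> 0 \<longrightarrow> x \<bullet> (A *v x) > 0)"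

section \<open>Markov chains on a finite state space\<close>

definition irreducible_chain :: "real ^ 's ^ 's \<Rightarrow> bool" where
  "irreducible_chain Q \<longleftrightarrow> (\<forall>s s'. \<exists>m. mat_pow Q m $ s $ s' > 0)"

definition period :: "real ^ 's ^ 's \<Rightarrow> 's \<Rightarrow> nat" where
  "period Q s = Gcd {m. m \<ge> 1 \<and> mat_pow Q m $ s $ s > 0}"

definition aperiodic_chain :: "real ^ 's ^ 's \<Rightarrow> bool" where
  "aperiodic_chain Q \<longleftrightarrow> (\<forall>s. period Q s = 1)"

definition ergodic_chain :: "real ^ 's ^ 's \<Rightarrow> bool" where
  "ergodic_chain Q \<longleftrightarrow> irreducible_chain Q \<and> aperiodic_chain Q"

definition stationary_dist :: "real ^ 's ^ 's \<Rightarrow> 's pmf \<Rightarrow> bool" where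
  "stationary_dist Q d \<longleftrightarrow> (\<forall>s'. (\<Sum>s\<in>UNIV. pmf d s * Q $ s $ s') = pmf d s')"

section \<open>Trajectories of a Markov decision process\<close>

definition policy_matrix ::
  "('s \<Rightarrow> 'a::finite \<Rightarrow> 's pmf) \<Rightarrow> ('s \<Rightarrow> 'a pmf) \<Rightarrow> real ^ 's ^ 's" where
  "policy_matrix P \<pi> = (\<chi> s s'. \<Sum>a\<in>UNIV. pmf (\<pi> s) a * pmf (P s a) s')"

text \<open>The conditional laws of \<open>A t\<close> and \<open>S (Suc t)\<close> given the whole past are stated in
  multiplied-out form, so that pasts of probability zero need no special treatment. The law of
  \<open>S 0\<close> is unconstrained.\<close>

locale mdp_trajectory = prob_space M
  for M :: "'w measure"
    and S :: "nat \<Rightarrow> 'w \<Rightarrow> 's::finite"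
    and A :: "nat \<Rightarrow> 'w \<Rightarrow> 'a::finite"
    and P :: "'s \<Rightarrow> 'a \<Rightarrow> 's pmf"
    and \<mu> :: "'s \<Rightarrow> 'a pmf" +
  assumes measurable_S: "\<And>t. S t \<in> measurable M (count_space UNIV)"
    and measurable_A: "\<And>t. A t \<in> measurable M (count_space UNIV)"
    and action_law: "\<And>t s a.
      \<P>(\<omega> in M. (\<forall>i\<le>t. S i \<omega> = s i) \<and> (\<forall>i\<le>t. A i \<omega> = a i))
        = \<P>(\<omega> in M. (\<forall>i\<le>t. S i \<omega> = s i) \<and> (\<forall>i<t. A i \<omega> = a i)) * pmf (\<mu> (s t)) (a t)"
    and state_law: "\<And>t s a.
      \<P>(\<omega> in M. (\<forall>i\<le>Suc t. S i \<omega> = s i) \<and> (\<forall>i\<le>t. A i \<omega> = a i))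
        = \<P>(\<omega> in M. (\<forall>i\<le>t. S i \<omega> = s i) \<and> (\<forall>i\<le>t. A i \<omega> = a i)) * pmf (P (s t) (a t)) (s (Suc t))"

section \<open>Followon trace\<close>

definition is_ratio ::
  "('s \<Rightarrow> 'a pmf) \<Rightarrow> ('s \<Rightarrow> 'a pmf) \<Rightarrow> (nat \<Rightarrow> 'w \<Rightarrow> 's) \<Rightarrow> (nat \<Rightarrow> 'w \<Rightarrow> 'a) \<Rightarrow> nat \<Rightarrow> 'w \<Rightarrow> real" where
  "is_ratio \<pi> \<mu> S A t \<omega> = pmf (\<pi> (S t \<omega>)) (A t \<omega>) / pmf (\<mu> (S t \<omega>)) (A t \<omega>)"

text \<open>The disjunct \<open>n = 0\<close> only serves termination.\<close>

function followon ::
  "('s \<Rightarrow> 'a pmf) \<Rightarrow> ('s \<Rightarrow> 'a pmf) \<Rightarrow> ('s \<Rightarrow> real) \<Rightarrow> nat \<Rightarrow>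
    (nat \<Rightarrow> 'w \<Rightarrow> 's) \<Rightarrow> (nat \<Rightarrow> 'w \<Rightarrow> 'a) \<Rightarrow> nat \<Rightarrow> 'w \<Rightarrow> real" where
  "followon \<pi> \<mu> \<gamma> n S A t \<omega> =
    (if n = 0 \<or> t < n then 1
     else (\<Prod>i\<in>{t - n..<t}. is_ratio \<pi> \<mu> S A i \<omega> * \<gamma> (S (Suc i) \<omega>))
            * followon \<pi> \<mu> \<gamma> n S A (t - n) \<omega> + 1)"
  by pat_completeness auto
termination
  by (relation "Wellfounded.measure (\<lambda>(\<pi>, \<mu>, \<gamma>, n, S, A, t, \<omega>). t)") auto

declare followon.simps [simp del]

text \<open>Elementary conditional expectation given an event (\<open>0\<close> if the event is null).\<close>

definition cond_expectation :: "'w measure \<Rightarrow> ('w \<Rightarrow> real) \<Rightarrow> ('w \<Rightarrow> bool) \<Rightarrow> real" where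
  "cond_expectation M X Q =
    (LINT \<omega>:{\<omega> \<in> space M. Q \<omega>}|M. X \<omega>) / \<P>(\<omega> in M. Q \<omega>)"

end

theory Submission
  imports Defs
begin

text \<open>
  Write \<open>L = (P\<^sub>\<pi> \<Gamma>)\<^sup>n\<close> and let \<open>m t s\<close> be the expectation of \<open>F\<^sub>t\<close> on the event \<open>S\<^sub>t = s\<close>. Importance
  sampling turns the recursion of the trace into \<open>m (t + n) = m t L + p (t + n)\<close> with \<open>p t\<close> the law of \<open>S\<^sub>t\<close>.
  Since \<open>m t s = p t s * E[F\<^sub>t | S\<^sub>t = s]\<close>, averaging over \<open>t\<close> along a subsequence on which the averages of
  \<open>p t\<close> converge, necessarily to the unique stationary distribution \<open>d\<close>, gives \<open>v = v L + d\<close> for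
  \<open>v s = d s * f s\<close>.
  Thus \<open>diag v (I - L)\<close> has column sums \<open>d > 0\<close> and nonnegative row sums, so its quadratic form is at least
  half that of \<open>diag d\<close>; the margin absorbs every perturbation of \<open>diag v\<close> of small operator norm.
\<close>

section \<open>Row vectors, matrix powers and operator norms\<close>

lemma vector_matrix_mult_nth: "(x v* A) $ j = (\<Sum>i\<in>UNIV. x $ i * A $ i $ j)"
  for x :: "real ^ 'n" and A :: "real ^ 'm ^ 'n"
  by (simp add: vector_matrix_mult_def mult.commute)

lemma vector_scaleR_matrix_mult: "(c *\<^sub>R x) v* A = c *\<^sub>R (x v* A)"
  for x :: "real ^ 'n" and A :: "real ^ 'm ^ 'n"
  by (simp add: vec_eq_iff vector_matrix_mult_nth sum_distrib_left mult.assoc)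

text \<open>\<open>mat_pow\<close> adds factors on the left, whereas a row vector evolving in time
  acquires its latest transition on the right.\<close>

lemma mat_pow_Suc_right: "mat_pow A (Suc m) = mat_pow A m ** A"
  by (induction m) (simp_all add: matrix_mul_assoc)

lemma mat_pow_nonneg:
  assumes "\<And>i j. 0 \<le> A $ i $ j"
  shows "0 \<le> mat_pow A m $ i $ j"
  using assms
  by (induction m arbitrary: i j) (auto simp: mat_def matrix_matrix_mult_def intro!: sum_nonneg)

lemma mat_pow_row_sum_le_1:
  assumes nonneg: "\<And>i j. 0 \<le> A $ i $ j" and row: "\<And>i. (\<Sum>j\<in>UNIV. A $ i $ j) \<le> 1"
  shows "(\<Sum>j\<in>UNIV. mat_pow A m $ i $ j) \<le> 1"
proof (induction m arbitrary: i)
  case 0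
  show ?case by (simp add: mat_def)
next
  case (Suc m)
  have "(\<Sum>j\<in>UNIV. mat_pow A (Suc m) $ i $ j)
      = (\<Sum>k\<in>UNIV. A $ i $ k * (\<Sum>j\<in>UNIV. mat_pow A m $ k $ j))"
    by (simp add: matrix_matrix_mult_def sum_distrib_left) (rule sum.swap)
  also have "\<dots> \<le> (\<Sum>k\<in>UNIV. A $ i $ k * 1)"
    by (intro sum_mono mult_left_mono Suc nonneg)
  also have "\<dots> \<le> 1"
    using row by simp
  finally show ?case .
qed

lemma vector_mat_pow_fixed:
  assumes "x v* A = x"
  shows "x v* mat_pow A m = x"
  using assms
  by (induction m) (simp_all flip: vector_matrix_mul_assoc)

lemma diag_mat_mult_nth: "(A ** diag_mat v) $ i $ j = A $ i $ j * v j"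
  by (simp add: matrix_matrix_mult_def diag_mat_def if_distrib cong: if_cong)

lemma diag_mat_vector_nth: "(diag_mat v *v x) $ i = v i * x $ i"
  by (simp add: matrix_vector_mult_def diag_mat_def if_distrib[of "\<lambda>a. a * _"] cong: if_cong)

lemma op_norm_bound: "norm (A *v x) \<le> op_norm A * norm x"
  unfolding op_norm_def by (intro onorm matrix_vector_mul_bounded_linear)

lemma op_norm_nonneg: "0 \<le> op_norm A"
  unfolding op_norm_def by (intro onorm_pos_le matrix_vector_mul_bounded_linear)

section \<open>Stationary vectors of irreducible matrices\<close>

text \<open>The mass at \<open>s\<close> reaches \<open>s'\<close> along a path of some length
  \<open>m\<close> with positive weight, and \<open>u\<close> is also fixed by the
  \<open>m\<close>-th power of \<open>Q\<close>.\<close>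

lemma irreducible_stationary_pos:
  assumes irr: "irreducible_chain Q" and Q: "\<And>s s'. 0 \<le> Q $ s $ s'"
    and u: "\<And>s. 0 \<le> u $ s" and fixed: "u v* Q = u" and s: "u $ s > 0"
  shows "u $ s' > 0"
proof -
  obtain m where m: "mat_pow Q m $ s $ s' > 0"
    using irr unfolding irreducible_chain_def by blast
  have "0 < u $ s * mat_pow Q m $ s $ s'"
    using s m by simp
  also have "\<dots> \<le> (u v* mat_pow Q m) $ s'"
    unfolding vector_matrix_mult_nth
    by (rule member_le_sum) (auto intro!: mult_nonneg_nonneg u mat_pow_nonneg Q)
  also have "\<dots> = u $ s'"
    by (simp add: vector_mat_pow_fixed[OF fixed])
  finally show ?thesis .
qed

text \<open>Subtract from \<open>u\<close> the largest multiple of \<open>d\<close> that keeps it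
  nonnegative. The difference \<open>w\<close> is again a fixed vector and vanishes at a minimiser
  of \<open>u / d\<close>. A positive entry of \<open>w\<close> would make every entry positive, so
  \<open>w = 0\<close>, and the normalisation forces the multiple to be 1.\<close>

lemma irreducible_stationary_unique:
  fixes u d :: "real ^ 's"
  assumes irr: "irreducible_chain Q" and Q: "\<And>s s'. 0 \<le> Q $ s $ s'"
    and u: "\<And>s. 0 \<le> u $ s" "u v* Q = u" "(\<Sum>s\<in>UNIV. u $ s) = 1"
    and d: "\<And>s. 0 < d $ s" "d v* Q = d" "(\<Sum>s\<in>UNIV. d $ s) = 1"
  shows "u = d"
proof -
  define c where "c = Min (range (\<lambda>s. u $ s / d $ s))"
  have "c \<in> range (\<lambda>s. u $ s / d $ s)"
    unfolding c_def by (rule Min_in) auto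
  then obtain s where s: "c = u $ s / d $ s" by blast
  have le: "c \<le> u $ i / d $ i" for i
    unfolding c_def by (rule Min_le) auto
  define w where "w = u - c *\<^sub>R d"
  have w0: "0 \<le> w $ i" for i
    using le[of i] d(1)[of i] by (simp add: w_def field_simps)
  have "w v* Q = u v* Q - c *\<^sub>R (d v* Q)"
    unfolding vec_eq_iff
    by (simp add: vector_matrix_mult_nth w_def algebra_simps sum_subtractf sum_distrib_left)
  then have wQ: "w v* Q = w"
    using u d by (simp add: w_def)
  have "w $ s = 0"
    using d(1)[of s] by (simp add: w_def s)
  then have "w $ i = 0" for i
    using irreducible_stationary_pos[OF irr Q w0 wQ, of i s] w0[of i] by force
  then have ud: "u $ i = c * d $ i" for i
    by (simp add: w_def)
  have "c = 1"
    using u(3) d(3) by (simp add: ud flip: sum_distrib_left)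
  then show ?thesis
    by (simp add: vec_eq_iff ud)
qed

text \<open>Windows \<open>{T..2T}\<close> rather than \<open>{..<T}\<close>: then averages of a null sequence are trivially null.\<close>

lemma irreducible_moving_average_limit:
  fixes p :: "nat \<Rightarrow> real ^ 's"
  assumes irr: "irreducible_chain Q" and Q: "\<And>s s'. 0 \<le> Q $ s $ s'"
    and p: "\<And>t s. 0 \<le> p t $ s" "\<And>t. (\<Sum>s\<in>UNIV. p t $ s) = 1" "\<And>t. p (Suc t) = p t v* Q"
    and d: "\<And>s. 0 < d $ s" "d v* Q = d" "(\<Sum>s\<in>UNIV. d $ s) = 1"
  shows "\<exists>r. strict_mono r \<and>
    (\<lambda>k. (1 / real (Suc (r k))) *\<^sub>R (\<Sum>t\<in>{r k..2 * r k}. p t)) \<longlonglongrightarrow> d"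
proof -
  define a where "a T = (1 / real (Suc T)) *\<^sub>R (\<Sum>t\<in>{T..2 * T}. p t)" for T
  have card: "card {T..2 * T} = Suc T" for T :: nat
    by simp
  have p_norm: "norm (p t) \<le> 1" for t
  proof -
    have "norm (p t) \<le> (\<Sum>s\<in>UNIV. \<bar>p t $ s\<bar>)"
      by (rule norm_le_l1_cart)
    then show ?thesis
      using p by simp
  qed
  have a0: "0 \<le> a T $ s" for T s
    using p by (simp add: a_def sum_nonneg)
  have a1: "(\<Sum>s\<in>UNIV. a T $ s) = 1" for T
  proof -
    have "(\<Sum>s\<in>UNIV. a T $ s) = (1 / real (Suc T)) * (\<Sum>s\<in>UNIV. \<Sum>t\<in>{T..2 * T}. p t $ s)"
      by (simp add: a_def sum_divide_distrib)
    also have "(\<Sum>s\<in>UNIV. \<Sum>t\<in>{T..2 * T}. p t $ s) = (\<Sum>t\<in>{T..2 * T}. \<Sum>s\<in>UNIV. p t $ s)"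
      by (rule sum.swap)
    also have "\<dots> = real (Suc T)"
      unfolding p(2) using card by simp
    finally show ?thesis by simp
  qed
  have a_norm: "norm (a T) \<le> 1" for T
  proof -
    have "norm (a T) \<le> (\<Sum>s\<in>UNIV. \<bar>a T $ s\<bar>)"
      by (rule norm_le_l1_cart)
    then show ?thesis
      using a0 a1 by simp
  qed
  \<comment> \<open>Applying \<open>Q\<close> shifts the window by one, so the difference telescopes
    to its two end terms; these are bounded, and the factor \<open>1 / Suc T\<close> makes
    \<open>a T\<close> asymptotically stationary.\<close>
  have aQ: "a T v* Q - a T = (1 / real (Suc T)) *\<^sub>R (p (Suc (2 * T)) - p T)" for T
  proof -
    have "(\<Sum>t\<in>{T..2 * T}. p t) v* Q = (\<Sum>t\<in>{T..2 * T}. p t v* Q)"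
      unfolding vec_eq_iff vector_matrix_mult_nth sum_component sum_distrib_right
      by (auto intro: sum.swap)
    then have "(\<Sum>t\<in>{T..2 * T}. p t) v* Q - (\<Sum>t\<in>{T..2 * T}. p t)
        = (\<Sum>t\<in>{T..2 * T}. p (Suc t) - p t)"
      by (simp add: p(3) sum_subtractf)
    also have "\<dots> = p (Suc (2 * T)) - p T"
      by (rule sum_Suc_diff) simp
    finally show ?thesis
      unfolding a_def by (simp add: vector_scaleR_matrix_mult flip: scaleR_diff_right del: of_nat_Suc)
  qed
  \<comment> \<open>Compactness supplies a subsequential limit \<open>u\<close>; it is a stationary
    probability vector, so uniqueness identifies it with \<open>d\<close>.\<close>
  have "a T \<in> cball 0 1" for T
    using a_norm by simp
  then obtain u r where r: "strict_mono r" and lim: "(a \<circ> r) \<longlonglongrightarrow> u"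
    using compact_cball[of "0 :: real ^ 's" 1] unfolding compact_def by blast
  have nth: "(\<lambda>k. a (r k) $ s) \<longlonglongrightarrow> u $ s" for s
    using tendsto_vec_nth[OF lim] by (simp add: o_def)
  have u0: "0 \<le> u $ s" for s
    using LIMSEQ_le_const[OF nth] a0 by blast
  have "(\<lambda>k. \<Sum>s\<in>UNIV. a (r k) $ s) \<longlonglongrightarrow> (\<Sum>s\<in>UNIV. u $ s)"
    by (intro tendsto_intros nth)
  then have u1: "(\<Sum>s\<in>UNIV. u $ s) = 1"
    using LIMSEQ_unique[OF _ tendsto_const] by (simp add: a1)
  have "(\<lambda>T. a T v* Q - a T) \<longlonglongrightarrow> 0"
  proof (rule Lim_null_comparison)
    show "\<forall>\<^sub>F T in sequentially. norm (a T v* Q - a T) \<le> 2 * (1 / real (Suc T))"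
    proof (rule always_eventually, rule allI)
      fix T
      have "norm (p (Suc (2 * T)) - p T) \<le> 2"
        using norm_triangle_ineq4[of "p (Suc (2 * T))" "p T"] p_norm[of T] p_norm[of "Suc (2 * T)"]
        by linarith
      then show "norm (a T v* Q - a T) \<le> 2 * (1 / real (Suc T))"
        unfolding aQ by (simp add: divide_right_mono)
    qed
    show "(\<lambda>T. 2 * (1 / real (Suc T))) \<longlonglongrightarrow> 0"
      using tendsto_mult_right_zero[OF LIMSEQ_Suc[OF lim_1_over_n], of 2] by simp
  qed
  then have "(\<lambda>k. a (r k) v* Q - a (r k)) \<longlonglongrightarrow> 0"
    using LIMSEQ_subseq_LIMSEQ[OF _ r] by (fastforce simp: o_def)
  moreover have "(\<lambda>k. a (r k) v* Q - a (r k)) \<longlonglongrightarrow> u v* Q - u"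
  proof (rule vec_tendstoI)
    show "(\<lambda>k. (a (r k) v* Q - a (r k)) $ s) \<longlonglongrightarrow> (u v* Q - u) $ s" for s
      unfolding vector_minus_component vector_matrix_mult_nth by (intro tendsto_intros nth)
  qed
  ultimately have "u v* Q - u = 0"
    by (rule LIMSEQ_unique[symmetric])
  then have "u = d"
    by (intro irreducible_stationary_unique[OF irr Q u0 _ u1 d]) auto
  then show ?thesis
    using r lim by (auto simp: a_def o_def)
qed

text \<open>Every index in the window is at least \<open>T\<close>, so once \<open>T \<ge> N\<close>
  all the averaged terms are small and no initial segment has to be split off.\<close>

lemma moving_average_null:
  fixes e :: "nat \<Rightarrow> real"
  assumes "e \<longlonglongrightarrow> 0"
  shows "(\<lambda>T. (\<Sum>t\<in>{T..2 * T}. e t) / real (Suc T)) \<longlonglongrightarrow> 0"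
proof (rule LIMSEQ_I)
  fix \<epsilon> :: real assume \<epsilon>: "0 < \<epsilon>"
  obtain N where N: "\<And>t. t \<ge> N \<Longrightarrow> \<bar>e t\<bar> < \<epsilon> / 2"
    using LIMSEQ_D[OF assms half_gt_zero[OF \<epsilon>]] by auto
  have "norm ((\<Sum>t\<in>{T..2 * T}. e t) / real (Suc T) - 0) < \<epsilon>" if "T \<ge> N" for T
  proof -
    have "\<bar>\<Sum>t\<in>{T..2 * T}. e t\<bar> \<le> (\<Sum>t\<in>{T..2 * T}. \<bar>e t\<bar>)"
      by (rule sum_abs)
    also have "\<dots> \<le> (\<Sum>t\<in>{T..2 * T}. \<epsilon> / 2)"
      using N that by (intro sum_mono less_imp_le) auto
    also have "\<dots> = real (Suc T) * (\<epsilon> / 2)"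
      by simp
    finally have "\<bar>\<Sum>t\<in>{T..2 * T}. e t\<bar> / real (Suc T) \<le> \<epsilon> / 2"
      by (simp add: field_simps)
    with \<epsilon> have "\<bar>\<Sum>t\<in>{T..2 * T}. e t\<bar> / real (Suc T) < \<epsilon>"
      by linarith
    then show ?thesis by (simp add: abs_divide del: of_nat_Suc)
  qed
  then show "\<exists>N. \<forall>T\<ge>N. norm ((\<Sum>t\<in>{T..2 * T}. e t) / real (Suc T) - 0) < \<epsilon>"
    by blast
qed

section \<open>Expectations along a trajectory\<close>

lemma policy_matrix_nonneg: "0 \<le> policy_matrix P \<pi> $ s $ s'"
  by (simp add: policy_matrix_def sum_nonneg)

lemma policy_matrix_row_sum: "(\<Sum>s'\<in>UNIV. policy_matrix P \<pi> $ s $ s') = 1"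
  for P :: "'s::finite \<Rightarrow> 'a::finite \<Rightarrow> 's pmf"
proof -
  have "(\<Sum>s'\<in>UNIV. policy_matrix P \<pi> $ s $ s')
      = (\<Sum>a\<in>UNIV. pmf (\<pi> s) a * (\<Sum>s'\<in>UNIV. pmf (P s a) s'))"
    by (simp add: policy_matrix_def sum_distrib_left) (rule sum.swap)
  then show ?thesis
    by (simp add: sum_pmf_eq_1)
qed

context mdp_trajectory
begin

section \<open>Histories and their cylinder events\<close>

text \<open>Stands for measurability with respect to the history just before the action at time
  \<open>t\<close> is drawn, hence \<open>\<le>\<close> for states but \<open><\<close> for actions.
  The condition ranges over all points of the type, not only over \<open>space M\<close>.\<close>

definition determined :: "nat \<Rightarrow> ('w \<Rightarrow> real) \<Rightarrow> bool" where
  "determined t X \<longleftrightarrow> (\<forall>\<omega> \<omega>'. (\<forall>i\<le>t. S i \<omega> = S i \<omega>') \<and> (\<forall>i<t. A i \<omega> = A i \<omega>') \<longrightarrow> X \<omega> = X \<omega>')"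

text \<open>Extensional functions give each history exactly one representative, which makes the set
  finite.\<close>

definition histories :: "nat \<Rightarrow> ((nat \<Rightarrow> 's) \<times> (nat \<Rightarrow> 'a)) set" where
  "histories t = ({..t} \<rightarrow>\<^sub>E UNIV) \<times> ({..<t} \<rightarrow>\<^sub>E UNIV)"

definition cylinder :: "nat \<Rightarrow> (nat \<Rightarrow> 's) \<times> (nat \<Rightarrow> 'a) \<Rightarrow> 'w set" where
  "cylinder t h = {\<omega> \<in> space M. (\<forall>i\<le>t. S i \<omega> = fst h i) \<and> (\<forall>i<t. A i \<omega> = snd h i)}"

lemma finite_histories: "finite (histories t)"
  unfolding histories_def by (intro finite_cartesian_product finite_PiE) auto

lemma S_event [measurable]: "Measurable.pred M (\<lambda>\<omega>. S i \<omega> = s)"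
  using measurable_S[of i] by measurable

lemma A_event [measurable]: "Measurable.pred M (\<lambda>\<omega>. A i \<omega> = a)"
  using measurable_A[of i] by measurable

lemma cylinder_sets [measurable]: "cylinder t h \<in> sets M"
  unfolding cylinder_def by measurable

text \<open>The action law followed by the state law, applied to the path that extends
  \<open>h\<close> by \<open>a\<close> and \<open>s'\<close>.\<close>

lemma cylinder_step:
  "prob {\<omega> \<in> cylinder t h. A t \<omega> = a \<and> S (Suc t) \<omega> = s'}
    = prob (cylinder t h) * (pmf (\<mu> (fst h t)) a * pmf (P (fst h t) a) s')"
proof -
  \<comment> \<open>Both updates are at indices that \<open>cylinder t h\<close> does not read, so
    the extended path still describes the same cylinder.\<close>
  let ?s = "(fst h)(Suc t := s')" and ?a = "(snd h)(t := a)"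
  have "{\<omega> \<in> cylinder t h. A t \<omega> = a \<and> S (Suc t) \<omega> = s'}
      = {\<omega> \<in> space M. (\<forall>i\<le>Suc t. S i \<omega> = ?s i) \<and> (\<forall>i\<le>t. A i \<omega> = ?a i)}"
  proof -
    have "(\<forall>i\<le>Suc t. S i \<omega> = ?s i) \<longleftrightarrow> (\<forall>i\<le>t. S i \<omega> = fst h i) \<and> S (Suc t) \<omega> = s'" for \<omega>
      by (auto simp: le_Suc_eq)
    moreover have "(\<forall>i\<le>t. A i \<omega> = ?a i) \<longleftrightarrow> (\<forall>i<t. A i \<omega> = snd h i) \<and> A t \<omega> = a" for \<omega>
      by (auto simp: le_less)
    ultimately show ?thesis
      by (auto simp: cylinder_def)
  qed
  moreover have "cylinder t h
      = {\<omega> \<in> space M. (\<forall>i\<le>t. S i \<omega> = ?s i) \<and> (\<forall>i<t. A i \<omega> = ?a i)}"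
    by (auto simp: cylinder_def)
  ultimately show ?thesis
    using state_law[of t ?s ?a] action_law[of t ?s ?a] by simp
qed

text \<open>Exactly one history in \<open>histories t\<close> has a cylinder containing
  \<open>\<omega>\<close>, and \<open>X\<close> is constant along it. The free factor
  \<open>g\<close> lets the same coefficients serve for \<open>X\<close> alone and for its products
  with quantities that look beyond time \<open>t\<close>.\<close>

lemma determined_decomposition:
  assumes "determined t X"
  obtains c where "\<forall>\<omega>\<in>space M. \<forall>g.
    X \<omega> * g = (\<Sum>h\<in>histories t. c h * (indicator (cylinder t h) \<omega> * g))"
proof
  define H where "H \<omega> = (restrict (\<lambda>i. S i \<omega>) {..t}, restrict (\<lambda>i. A i \<omega>) {..<t})" for \<omega>
  have H_nth: "i \<le> t \<Longrightarrow> fst (H \<omega>) i = S i \<omega>" "i < t \<Longrightarrow> snd (H \<omega>) i = A i \<omega>" for \<omega> i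
    by (simp_all add: H_def)
  \<comment> \<open>The chosen point may lie outside \<open>space M\<close>; this is harmless
    because \<open>determined\<close> constrains \<open>X\<close> everywhere.\<close>
  define c where "c h = X (SOME \<omega>. H \<omega> = h)" for h
  show "\<forall>\<omega>\<in>space M. \<forall>g.
    X \<omega> * g = (\<Sum>h\<in>histories t. c h * (indicator (cylinder t h) \<omega> * g))"
  proof (intro ballI allI)
    fix \<omega> g assume \<omega>: "\<omega> \<in> space M"
    have H_mem: "H \<omega> \<in> histories t"
      by (auto simp: H_def histories_def)
    have cyl: "\<omega> \<in> cylinder t h \<longleftrightarrow> h = H \<omega>" if "h \<in> histories t" for h
    proof
      assume "\<omega> \<in> cylinder t h"
      then have "fst h = fst (H \<omega>)" "snd h = snd (H \<omega>)"
        using that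
        by (auto simp: cylinder_def histories_def H_def restrict_def fun_eq_iff PiE_def extensional_def)
      then show "h = H \<omega>"
        by (rule prod_eqI)
    next
      assume "h = H \<omega>"
      then show "\<omega> \<in> cylinder t h"
        using \<omega> by (auto simp: cylinder_def H_def)
    qed
    have "H (SOME \<omega>'. H \<omega>' = H \<omega>) = H \<omega>"
      by (rule someI) (rule refl)
    then have "(\<forall>i\<le>t. S i (SOME \<omega>'. H \<omega>' = H \<omega>) = S i \<omega>) \<and> (\<forall>i<t. A i (SOME \<omega>'. H \<omega>' = H \<omega>) = A i \<omega>)"
      using H_nth by metis
    then have "c (H \<omega>) = X \<omega>"
      using assms unfolding determined_def c_def by blast
    moreover have "(\<Sum>h\<in>histories t. c h * (indicator (cylinder t h) \<omega> * g))
        = (\<Sum>h\<in>histories t. if h = H \<omega> then c h * g else 0)"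
      by (intro sum.cong) (auto simp: cyl)
    ultimately show "X \<omega> * g = (\<Sum>h\<in>histories t. c h * (indicator (cylinder t h) \<omega> * g))"
      using H_mem by (simp add: finite_histories)
  qed
qed

text \<open>With \<open>g = 1\<close> the decomposition exhibits \<open>X\<close> on
  \<open>space M\<close> as a finite combination of indicators of measurable sets, so measurability
  and boundedness come for free.\<close>

lemma determined_integrable:
  assumes "determined t X"
  shows "integrable M X"
proof -
  obtain c where c: "\<forall>\<omega>\<in>space M. \<forall>g.
      X \<omega> * g = (\<Sum>h\<in>histories t. c h * (indicator (cylinder t h) \<omega> * g))"
    using determined_decomposition[OF assms] .
  have "integrable M (\<lambda>\<omega>. \<Sum>h\<in>histories t. c h * indicator (cylinder t h) \<omega>)"
    by (intro Bochner_Integration.integrable_sum integrable_mult_right integrable_real_indicator)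
      (auto simp: emeasure_eq_measure)
  then show ?thesis
    using c[rule_format, of _ 1] by (subst Bochner_Integration.integrable_cong[OF refl]) auto
qed

text \<open>The Markov property in integrated form: \<open>w\<close> is replaced by its conditional
  mean given \<open>S t\<close>. On each cylinder \<open>w\<close> is a combination of indicators of
  the one-step extensions \<open>E\<close>, whose probabilities \<open>cylinder_step\<close>
  provides; the decomposition of \<open>X\<close> is then read backwards.\<close>

lemma expectation_step:
  assumes X: "determined t X"
  shows "expectation (\<lambda>\<omega>. X \<omega> * w (S t \<omega>) (A t \<omega>) (S (Suc t) \<omega>))
    = expectation (\<lambda>\<omega>. X \<omega> *
        (\<Sum>a\<in>UNIV. \<Sum>s'\<in>UNIV. pmf (\<mu> (S t \<omega>)) a * pmf (P (S t \<omega>) a) s' * w (S t \<omega>) a s'))"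
    (is "?lhs = expectation (\<lambda>\<omega>. X \<omega> * ?k (S t \<omega>))")
proof -
  obtain c where c: "\<forall>\<omega>\<in>space M. \<forall>g.
      X \<omega> * g = (\<Sum>h\<in>histories t. c h * (indicator (cylinder t h) \<omega> * g))"
    using determined_decomposition[OF X] .
  define E where "E h a s' = {\<omega> \<in> cylinder t h. A t \<omega> = a \<and> S (Suc t) \<omega> = s'}" for h a s'
  have E [measurable]: "E h a s' \<in> sets M" for h a s'
    unfolding E_def by measurable
  have integrable_E: "integrable M (indicat_real (E h a s'))" for h a s'
    by (simp add: integrable_real_indicator emeasure_eq_measure)
  have integral_E: "expectation (indicat_real (E h a s')) = prob (E h a s')" for h a s'
    by simp
  have split: "indicator (cylinder t h) \<omega> * w (S t \<omega>) (A t \<omega>) (S (Suc t) \<omega>)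
      = (\<Sum>a\<in>UNIV. \<Sum>s'\<in>UNIV. w (fst h t) a s' * indicator (E h a s') \<omega>)" for h \<omega>
  proof -
    have "(\<Sum>a\<in>UNIV. \<Sum>s'\<in>UNIV. w (fst h t) a s' * indicator (E h a s') \<omega>)
       = (\<Sum>a\<in>UNIV. \<Sum>s'\<in>UNIV. if s' = S (Suc t) \<omega> then
            (if a = A t \<omega> then indicator (cylinder t h) \<omega> * w (fst h t) a s' else 0) else 0)"
      by (intro sum.cong refl) (auto simp: E_def indicator_def)
    also have "\<dots> = indicator (cylinder t h) \<omega> * w (fst h t) (A t \<omega>) (S (Suc t) \<omega>)"
      by simp
    also have "\<dots> = indicator (cylinder t h) \<omega> * w (S t \<omega>) (A t \<omega>) (S (Suc t) \<omega>)"
      by (auto simp: cylinder_def indicator_def)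
    finally show ?thesis ..
  qed
  have "?lhs = expectation (\<lambda>\<omega>. \<Sum>h\<in>histories t. c h *
      (\<Sum>a\<in>UNIV. \<Sum>s'\<in>UNIV. w (fst h t) a s' * indicator (E h a s') \<omega>))"
    by (intro Bochner_Integration.integral_cong refl) (simp only: c split)
  also have "\<dots> = (\<Sum>h\<in>histories t. c h * (\<Sum>a\<in>UNIV. \<Sum>s'\<in>UNIV. w (fst h t) a s' * prob (E h a s')))"
    by (simp only: Bochner_Integration.integral_sum Bochner_Integration.integrable_sum
        integrable_mult_right integral_mult_right_zero integrable_E integral_E)
  also have "\<dots> = (\<Sum>h\<in>histories t. c h * (prob (cylinder t h) * ?k (fst h t)))"
    unfolding E_def cylinder_step by (simp add: sum_distrib_left mult_ac)
  also have "\<dots> = expectation (\<lambda>\<omega>. \<Sum>h\<in>histories t. c h * (indicator (cylinder t h) \<omega> * ?k (fst h t)))"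
    by (simp add: emeasure_eq_measure)
  also have "\<dots> = expectation (\<lambda>\<omega>. X \<omega> * ?k (S t \<omega>))"
  proof (intro Bochner_Integration.integral_cong refl)
    fix \<omega> assume \<omega>: "\<omega> \<in> space M"
    have "indicator (cylinder t h) \<omega> * ?k (S t \<omega>) = indicator (cylinder t h) \<omega> * ?k (fst h t)" for h
    proof (cases "\<omega> \<in> cylinder t h")
      case True
      then have "S t \<omega> = fst h t"
        by (simp add: cylinder_def)
      then show ?thesis by (simp only:)
    qed simp
    then show "(\<Sum>h\<in>histories t. c h * (indicator (cylinder t h) \<omega> * ?k (fst h t))) = X \<omega> * ?k (S t \<omega>)"
      using c \<omega> by (simp only:)
  qed
  finally show ?thesis .
qed

section \<open>State moments and their transport by matrices\<close>

text \<open>The expectation of \<open>X\<close> on the event \<open>S t = s\<close>, left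
  unnormalised so that it evolves linearly and states of probability zero need no division.\<close>

definition state_moment :: "nat \<Rightarrow> ('w \<Rightarrow> real) \<Rightarrow> real ^ 's" where
  "state_moment t X = (\<chi> s. expectation (\<lambda>\<omega>. X \<omega> * of_bool (S t \<omega> = s)))"

lemma determined_mult:
  "determined t X \<Longrightarrow> determined t Y \<Longrightarrow> determined t (\<lambda>\<omega>. X \<omega> * Y \<omega>)"
  unfolding determined_def by (intro allI impI arg_cong2[where f = "(*)"]) blast+

lemma determined_state: "i \<le> t \<Longrightarrow> determined t (\<lambda>\<omega>. g (S i \<omega>))"
  by (simp add: determined_def)

lemma determined_mono: "determined t X \<Longrightarrow> t \<le> t' \<Longrightarrow> determined t' X"
  unfolding determined_def by (blast intro: le_trans less_le_trans)

lemma expectation_state_split: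
  assumes "determined t X"
  shows "expectation (\<lambda>\<omega>. X \<omega> * k (S t \<omega>)) = (\<Sum>s\<in>UNIV. state_moment t X $ s * k s)"
proof -
  have "X \<omega> * k (S t \<omega>) = (\<Sum>s\<in>UNIV. X \<omega> * of_bool (S t \<omega> = s) * k s)" for \<omega>
  proof -
    have "(\<Sum>s\<in>UNIV. X \<omega> * of_bool (S t \<omega> = s) * k s) = (\<Sum>s\<in>UNIV. if S t \<omega> = s then X \<omega> * k s else 0)"
      by (intro sum.cong) auto
    then show ?thesis by simp
  qed
  moreover have "integrable M (\<lambda>\<omega>. X \<omega> * of_bool (S t \<omega> = s))" for s
    by (intro determined_integrable[of t] determined_mult assms
        determined_state[of t t "\<lambda>x. of_bool (x = s)"] order_refl)
  ultimately show ?thesis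
    by (simp add: state_moment_def)
qed

text \<open>A weighted step of the process acts on moments as right multiplication by
  \<open>B\<close>. The weight 1 yields the transition matrix of \<open>\<mu>\<close>; the
  importance ratio times the discount yields
  \<open>policy_matrix P \<pi> ** diag_mat \<gamma>\<close>.\<close>

lemma state_moment_step:
  assumes "determined t X"
    and B: "\<And>s s'. B $ s $ s' = (\<Sum>a\<in>UNIV. pmf (\<mu> s) a * pmf (P s a) s' * w s a s')"
  shows "state_moment (Suc t) (\<lambda>\<omega>. X \<omega> * w (S t \<omega>) (A t \<omega>) (S (Suc t) \<omega>)) = state_moment t X v* B"
proof -
  have "state_moment (Suc t) (\<lambda>\<omega>. X \<omega> * w (S t \<omega>) (A t \<omega>) (S (Suc t) \<omega>)) $ s'
      = (\<Sum>s\<in>UNIV. state_moment t X $ s * B $ s $ s')" for s'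
  proof -
    have "state_moment (Suc t) (\<lambda>\<omega>. X \<omega> * w (S t \<omega>) (A t \<omega>) (S (Suc t) \<omega>)) $ s'
      = expectation (\<lambda>\<omega>. X \<omega> * (w (S t \<omega>) (A t \<omega>) (S (Suc t) \<omega>) * of_bool (S (Suc t) \<omega> = s')))"
      by (simp add: state_moment_def mult_ac)
    also have "\<dots> = expectation (\<lambda>\<omega>. X \<omega> * (\<Sum>a\<in>UNIV. \<Sum>s''\<in>UNIV.
        pmf (\<mu> (S t \<omega>)) a * pmf (P (S t \<omega>) a) s'' * (w (S t \<omega>) a s'' * of_bool (s'' = s'))))"
      using expectation_step[OF assms(1), of "\<lambda>s a s''. w s a s'' * of_bool (s'' = s')"] .
    also have "\<dots> = expectation (\<lambda>\<omega>. X \<omega> * B $ S t \<omega> $ s')"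
      by (simp add: B of_bool_def if_distrib cong: if_cong)
    also have "\<dots> = (\<Sum>s\<in>UNIV. state_moment t X $ s * B $ s $ s')"
      by (rule expectation_state_split[OF assms(1)])
    finally show ?thesis .
  qed
  then show ?thesis
    by (simp add: vec_eq_iff vector_matrix_mult_nth)
qed

definition state_law_vec :: "nat \<Rightarrow> real ^ 's" where
  "state_law_vec t = (\<chi> s. \<P>(\<omega> in M. S t \<omega> = s))"

lemma state_law_vec_nonneg: "0 \<le> state_law_vec t $ s"
  by (simp add: state_law_vec_def)

lemma state_moment_1: "state_moment t (\<lambda>_. 1) = state_law_vec t"
proof -
  have "expectation (\<lambda>\<omega>. of_bool (S t \<omega> = s)) = \<P>(\<omega> in M. S t \<omega> = s)" for s
  proof -
    have "expectation (\<lambda>\<omega>. of_bool (S t \<omega> = s) :: real) = expectation (indicator {\<omega> \<in> space M. S t \<omega> = s})"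
      by (intro Bochner_Integration.integral_cong) (auto simp: indicator_def)
    then show ?thesis by simp
  qed
  then show ?thesis
    by (simp add: state_moment_def state_law_vec_def)
qed

lemma determined_const: "determined t (\<lambda>_. c)"
  by (simp add: determined_def)

lemma state_law_vec_sum: "(\<Sum>s\<in>UNIV. state_law_vec t $ s) = 1"
  using expectation_state_split[OF determined_const[of t 1], of "\<lambda>_. 1"]
  by (simp add: state_moment_1 prob_space)

lemma state_law_vec_Suc: "state_law_vec (Suc t) = state_law_vec t v* policy_matrix P \<mu>"
  using state_moment_step[OF determined_const[of t 1], of "policy_matrix P \<mu>" "\<lambda>_ _ _. 1"]
  by (simp add: state_moment_1 policy_matrix_def)

lemma state_law_vec_add: "state_law_vec (t + k) = state_law_vec t v* mat_pow (policy_matrix P \<mu>) k"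
  by (induction k)
    (simp_all add: state_law_vec_Suc vector_matrix_mul_assoc mat_pow_Suc_right del: mat_pow.simps(2))

section \<open>Moments of the followon trace\<close>

text \<open>The last factor has index \<open>l - 1\<close>; it reads the action at
  \<open>l - 1\<close> and, through the discount, the state at \<open>l\<close>, which is just
  within the history at time \<open>l\<close>.\<close>

lemma determined_trace_factor:
  assumes "l \<le> t"
  shows "determined t (\<lambda>\<omega>. \<Prod>i\<in>{k..<l}. is_ratio \<pi> \<mu> S A i \<omega> * \<gamma> (S (Suc i) \<omega>))"
  unfolding determined_def
proof (intro allI impI prod.cong refl)
  fix \<omega> \<omega>' i
  assume "(\<forall>i\<le>t. S i \<omega> = S i \<omega>') \<and> (\<forall>i<t. A i \<omega> = A i \<omega>')" and "i \<in> {k..<l}"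
  with assms show "is_ratio \<pi> \<mu> S A i \<omega> * \<gamma> (S (Suc i) \<omega>)
      = is_ratio \<pi> \<mu> S A i \<omega>' * \<gamma> (S (Suc i) \<omega>')"
    by (simp add: is_ratio_def)
qed

lemma determined_followon: "determined t (followon \<pi> \<mu> \<gamma> n S A t)"
proof (induction t rule: less_induct)
  case (less t)
  show ?case
  proof (cases "n = 0 \<or> t < n")
    case True
    then show ?thesis
      by (simp add: followon.simps determined_def)
  next
    case False
    let ?G = "\<lambda>\<omega>. (\<Prod>i\<in>{t - n..<t}. is_ratio \<pi> \<mu> S A i \<omega> * \<gamma> (S (Suc i) \<omega>))
        * followon \<pi> \<mu> \<gamma> n S A (t - n) \<omega>"
    have "determined t ?G"
      using False
      by (intro determined_mult determined_trace_factor determined_mono[OF less]) auto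
    then have "determined t (\<lambda>\<omega>. ?G \<omega> + 1)"
      unfolding determined_def by (intro allI impI arg_cong2[where f = "(+)"]) blast+
    moreover have "followon \<pi> \<mu> \<gamma> n S A t = (\<lambda>\<omega>. ?G \<omega> + 1)"
      using False by (subst followon.simps[abs_def]) simp
    ultimately show ?thesis by simp
  qed
qed

text \<open>Importance sampling: in each step the behaviour probability cancels the denominator of
  the ratio, so the weighted moments evolve under the discounted target chain.\<close>

lemma state_moment_weighted:
  assumes X: "determined t X"
    and coverage: "\<And>s a. pmf (\<pi> s) a > 0 \<Longrightarrow> pmf (\<mu> s) a > 0"
  shows "state_moment (t + k) (\<lambda>\<omega>. X \<omega> * (\<Prod>i\<in>{t..<t + k}. is_ratio \<pi> \<mu> S A i \<omega> * \<gamma> (S (Suc i) \<omega>)))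
    = state_moment t X v* mat_pow (policy_matrix P \<pi> ** diag_mat \<gamma>) k"
proof (induction k)
  case 0
  show ?case by simp
next
  case (Suc k)
  let ?B = "policy_matrix P \<pi> ** diag_mat \<gamma>"
  let ?w = "\<lambda>s a s'. pmf (\<pi> s) a / pmf (\<mu> s) a * \<gamma> s'"
  let ?X = "\<lambda>\<omega>. X \<omega> * (\<Prod>i\<in>{t..<t + k}. is_ratio \<pi> \<mu> S A i \<omega> * \<gamma> (S (Suc i) \<omega>))"
  \<comment> \<open>Where the target probability is positive, coverage excludes division by zero;
    elsewhere both sides vanish.\<close>
  have cancel: "pmf (\<mu> s) a * (pmf (\<pi> s) a / pmf (\<mu> s) a) = pmf (\<pi> s) a" for s a
  proof (cases "pmf (\<pi> s) a > 0")
    case True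
    then show ?thesis
      using coverage[of s a] by simp
  next
    case False
    then have "pmf (\<pi> s) a = 0"
      using pmf_nonneg[of "\<pi> s" a] by linarith
    then show ?thesis by simp
  qed
  have B: "?B $ s $ s' = (\<Sum>a\<in>UNIV. pmf (\<mu> s) a * pmf (P s a) s' * ?w s a s')" for s s'
  proof -
    have "(\<Sum>a\<in>UNIV. pmf (\<mu> s) a * pmf (P s a) s' * ?w s a s')
      = (\<Sum>a\<in>UNIV. pmf (\<mu> s) a * (pmf (\<pi> s) a / pmf (\<mu> s) a) * pmf (P s a) s' * \<gamma> s')"
      by (simp only: mult_ac)
    also have "\<dots> = ?B $ s $ s'"
      unfolding cancel by (simp add: diag_mat_mult_nth policy_matrix_def sum_distrib_right)
    finally show ?thesis ..
  qed
  have "determined (t + k) ?X"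
    by (intro determined_mult determined_mono[OF X] determined_trace_factor) auto
  from state_moment_step[OF this B]
  have "state_moment (Suc (t + k)) (\<lambda>\<omega>. ?X \<omega> * ?w (S (t + k) \<omega>) (A (t + k) \<omega>) (S (Suc (t + k)) \<omega>))
      = state_moment t X v* mat_pow ?B (Suc k)"
    unfolding Suc by (simp add: vector_matrix_mul_assoc mat_pow_Suc_right del: mat_pow.simps(2))
  then show ?case
    by (simp add: is_ratio_def mult_ac)
qed

lemma state_moment_add:
  assumes "determined t X" "determined t Y"
  shows "state_moment t (\<lambda>\<omega>. X \<omega> + Y \<omega>) = state_moment t X + state_moment t Y"
proof -
  have "integrable M (\<lambda>\<omega>. X \<omega> * of_bool (S t \<omega> = s))" "integrable M (\<lambda>\<omega>. Y \<omega> * of_bool (S t \<omega> = s))" for s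
    by (intro determined_integrable[of t] determined_mult assms
        determined_state[of t t "\<lambda>x. of_bool (x = s)"] order_refl)+
  then show ?thesis
    by (simp add: state_moment_def vec_eq_iff distrib_right)
qed

text \<open>One block of \<open>n\<close> steps of the trace: the product transports the moment of
  the trace at time \<open>t\<close>, and the summand 1 contributes the law of the state at time
  \<open>t + n\<close>.\<close>

lemma followon_moment_recursion:
  assumes coverage: "\<And>s a. pmf (\<pi> s) a > 0 \<Longrightarrow> pmf (\<mu> s) a > 0" and n: "n \<ge> 1"
  shows "state_moment (t + n) (followon \<pi> \<mu> \<gamma> n S A (t + n))
    = state_moment t (followon \<pi> \<mu> \<gamma> n S A t) v* mat_pow (policy_matrix P \<pi> ** diag_mat \<gamma>) n
      + state_law_vec (t + n)"
proof -
  let ?G = "\<lambda>\<omega>. followon \<pi> \<mu> \<gamma> n S A t \<omega> * (\<Prod>i\<in>{t..<t + n}. is_ratio \<pi> \<mu> S A i \<omega> * \<gamma> (S (Suc i) \<omega>))"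
  have "followon \<pi> \<mu> \<gamma> n S A (t + n) = (\<lambda>\<omega>. ?G \<omega> + 1)"
    using n by (subst followon.simps[abs_def]) (simp add: mult.commute)
  moreover have "determined (t + n) ?G"
    by (intro determined_mult determined_mono[OF determined_followon] determined_trace_factor) auto
  ultimately show ?thesis
    using state_moment_weighted[OF determined_followon coverage]
    by (simp add: state_moment_add determined_const state_moment_1)
qed

text \<open>On an event of positive probability this is the definition multiplied out. On a null
  event the left side is an integral of an almost surely vanishing function and the right side has
  the factor 0.\<close>

lemma state_moment_cond_expectation:
  "state_moment t X $ s = state_law_vec t $ s * cond_expectation M X (\<lambda>\<omega>. S t \<omega> = s)"
proof -
  have eq: "state_moment t X $ s = (LINT \<omega>:{\<omega> \<in> space M. S t \<omega> = s}|M. X \<omega>)"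
    unfolding state_moment_def set_lebesgue_integral_def
    by (auto intro!: Bochner_Integration.integral_cong)
  show ?thesis
  proof (cases "\<P>(\<omega> in M. S t \<omega> = s) = 0")
    case True
    then have "{\<omega> \<in> space M. S t \<omega> = s} \<in> null_sets M"
      by (auto simp: null_sets_def emeasure_eq_measure)
    then have "AE \<omega> in M. X \<omega> * of_bool (S t \<omega> = s) = 0"
      by (rule AE_I') auto
    then have "state_moment t X $ s = 0"
      unfolding state_moment_def by (simp add: integral_eq_zero_AE)
    with True show ?thesis
      by (simp add: state_law_vec_def)
  next
    case False
    then show ?thesis
      by (simp add: eq cond_expectation_def state_law_vec_def)
  qed
qed

lemma followon_nonneg:
  assumes "\<And>s. 0 \<le> \<gamma> s"
  shows "0 \<le> followon \<pi> \<mu> \<gamma> n S A t \<omega>"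
proof (induction t rule: less_induct)
  case (less t)
  then show ?case
    by (subst followon.simps)
      (auto intro!: add_nonneg_nonneg mult_nonneg_nonneg prod_nonneg divide_nonneg_nonneg assms simp: is_ratio_def)
qed

section \<open>The limiting trace and its fixed-point equation\<close>

lemma followon_limit_nonneg:
  assumes "\<And>s. 0 \<le> \<gamma> s"
    and "(\<lambda>t. cond_expectation M (followon \<pi> \<mu> \<gamma> n S A t) (\<lambda>\<omega>. S t \<omega> = s)) \<longlonglongrightarrow> l"
  shows "0 \<le> l"
proof (rule LIMSEQ_le_const[OF assms(2)])
  have "0 \<le> cond_expectation M (followon \<pi> \<mu> \<gamma> n S A t) (\<lambda>\<omega>. S t \<omega> = s)" for t
    unfolding cond_expectation_def set_lebesgue_integral_def
    by (intro divide_nonneg_nonneg Bochner_Integration.integral_nonneg)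
      (auto intro!: mult_nonneg_nonneg followon_nonneg assms(1))
  then show "\<exists>N. \<forall>t\<ge>N. 0 \<le> cond_expectation M (followon \<pi> \<mu> \<gamma> n S A t) (\<lambda>\<omega>. S t \<omega> = s)"
    by blast
qed

text \<open>The recursion holds exactly for the conditional expectations \<open>c t\<close>;
  replacing them by \<open>f\<close> costs a null sequence. The resulting defect is linear in the
  state law, so averaging it over windows transfers the equation to \<open>d\<close>.\<close>

lemma followon_limit_equation:
  fixes d :: "real ^ 's" and f :: "'s \<Rightarrow> real"
  assumes irr: "irreducible_chain (policy_matrix P \<mu>)"
    and d: "\<And>s. 0 < d $ s" "d v* policy_matrix P \<mu> = d" "(\<Sum>s\<in>UNIV. d $ s) = 1"
    and coverage: "\<And>s a. pmf (\<pi> s) a > 0 \<Longrightarrow> pmf (\<mu> s) a > 0" and n: "n \<ge> 1"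
    and lim: "\<And>s. (\<lambda>t. cond_expectation M (followon \<pi> \<mu> \<gamma> n S A t) (\<lambda>\<omega>. S t \<omega> = s)) \<longlonglongrightarrow> f s"
  shows "d $ s' * f s' = (\<Sum>s\<in>UNIV. d $ s * f s * mat_pow (policy_matrix P \<pi> ** diag_mat \<gamma>) n $ s $ s') + d $ s'"
proof -
  let ?Q = "policy_matrix P \<mu>"
  let ?Qn = "mat_pow ?Q n"
  let ?L = "mat_pow (policy_matrix P \<pi> ** diag_mat \<gamma>) n"
  let ?p = state_law_vec
  define c where "c t s = cond_expectation M (followon \<pi> \<mu> \<gamma> n S A t) (\<lambda>\<omega>. S t \<omega> = s)" for t s
  have clim: "(\<lambda>t. c t s - f s) \<longlonglongrightarrow> 0" for s
    using lim[of s] unfolding c_def by (rule LIM_zero)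
  have p_le: "\<bar>?p t $ s\<bar> \<le> 1" for t s
    by (simp add: state_law_vec_def)
  \<comment> \<open>The shift \<open>i\<close> is used with the values 0 and \<open>n\<close>, the
    two times that occur in the recursion.\<close>
  have err: "(\<lambda>t. ?p (t + i) $ s * (c (t + i) s - f s)) \<longlonglongrightarrow> 0" for s i
  proof (rule Lim_null_comparison)
    show "\<forall>\<^sub>F t in sequentially. norm (?p (t + i) $ s * (c (t + i) s - f s)) \<le> norm (c (t + i) s - f s)"
      using p_le by (intro always_eventually allI) (simp add: abs_mult mult_left_le_one_le)
    show "(\<lambda>t. norm (c (t + i) s - f s)) \<longlonglongrightarrow> 0"
      using LIMSEQ_ignore_initial_segment[OF clim[of s], of i] by (rule tendsto_norm_zero)
  qed
  \<comment> \<open>The defect of the claimed equation when the state law is \<open>q\<close> now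
    and \<open>q v* ?Qn\<close> after \<open>n\<close> steps. The two laws are kept apart because
    \<open>?p t\<close> need not be stationary; at \<open>q = d\<close> they coincide and
    \<open>e d = 0\<close> is the claim.\<close>
  define e where "e q = (q v* ?Qn) $ s' * f s' - (\<Sum>s\<in>UNIV. q $ s * f s * ?L $ s $ s') - (q v* ?Qn) $ s'"
    for q :: "real ^ 's"
  have "e (?p t) = (\<Sum>s\<in>UNIV. ?p (t + 0) $ s * (c (t + 0) s - f s) * ?L $ s $ s')
      - ?p (t + n) $ s' * (c (t + n) s' - f s')" for t
  proof -
    have "?p (t + n) $ s' * c (t + n) s' = (\<Sum>s\<in>UNIV. ?p t $ s * c t s * ?L $ s $ s') + ?p (t + n) $ s'"
      using arg_cong[OF followon_moment_recursion[where t = t and \<gamma> = \<gamma> and \<pi> = \<pi>, OF _ n],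
          where f = "\<lambda>v. v $ s'"] coverage
      by (simp add: state_moment_cond_expectation vector_matrix_mult_nth c_def)
    then show ?thesis
      by (simp add: e_def flip: state_law_vec_add) (simp add: algebra_simps sum_subtractf)
  qed
  moreover have "(\<lambda>t. (\<Sum>s\<in>UNIV. ?p (t + 0) $ s * (c (t + 0) s - f s) * ?L $ s $ s')
      - ?p (t + n) $ s' * (c (t + n) s' - f s')) \<longlonglongrightarrow> 0"
    by (intro tendsto_diff[where a = 0 and b = 0, simplified] tendsto_null_sum tendsto_mult_left_zero err)
  ultimately have "(\<lambda>t. e (?p t)) \<longlonglongrightarrow> 0"
    by simp
  then have avg0: "(\<lambda>T. (\<Sum>t\<in>{T..2 * T}. e (?p t)) / real (Suc T)) \<longlonglongrightarrow> 0"
    by (rule moving_average_null)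
  obtain r where r: "strict_mono r"
    and rlim: "(\<lambda>k. (1 / real (Suc (r k))) *\<^sub>R (\<Sum>t\<in>{r k..2 * r k}. ?p t)) \<longlonglongrightarrow> d"
    using irreducible_moving_average_limit[where p = ?p, OF irr policy_matrix_nonneg state_law_vec_nonneg
        state_law_vec_sum state_law_vec_Suc d] by blast
  \<comment> \<open>Linearity lets \<open>e\<close> commute with the window averages and, in finite
    dimension, gives the continuity needed for the limit.\<close>
  have e_lin: "linear e"
    unfolding e_def vector_matrix_mult_nth
    by (intro linearI) (simp_all add: algebra_simps sum.distrib sum_distrib_left)
  have "(\<lambda>k. e ((1 / real (Suc (r k))) *\<^sub>R (\<Sum>t\<in>{r k..2 * r k}. ?p t))) \<longlonglongrightarrow> e d"
    using rlim linear_continuous_at[OF linear_conv_bounded_linear[THEN iffD1, OF e_lin]]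
    by (rule isCont_tendsto_compose[rotated])
  moreover have "(\<lambda>k. e ((1 / real (Suc (r k))) *\<^sub>R (\<Sum>t\<in>{r k..2 * r k}. ?p t))) \<longlonglongrightarrow> 0"
    using LIMSEQ_subseq_LIMSEQ[OF avg0 r]
    by (simp add: o_def linear_scale[OF e_lin] linear_sum[OF e_lin] del: of_nat_Suc)
  ultimately have "e d = 0"
    by (rule LIMSEQ_unique)
  then show ?thesis
    by (simp add: e_def vector_mat_pow_fixed[OF d(2)])
qed

end

section \<open>Positive definiteness\<close>

text \<open>The column sums of \<open>diag_mat v ** (mat 1 - L)\<close> are the entries of \<open>d\<close> and its row sums are nonnegative,
  so its symmetric part is diagonally dominant.\<close>

lemma emphasis_quadratic_form:
  fixes L :: "real ^ 's ^ 's"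
  assumes L: "\<And>s s'. 0 \<le> L $ s $ s'" "\<And>s. (\<Sum>s'\<in>UNIV. L $ s $ s') \<le> 1"
    and v: "\<And>s. 0 \<le> v s" "\<And>s'. v s' = (\<Sum>s\<in>UNIV. v s * L $ s $ s') + d s'"
  shows "(\<Sum>s\<in>UNIV. d s * (x $ s)\<^sup>2) / 2 \<le> x \<bullet> (diag_mat v *v ((mat 1 - L) *v x))"
proof -
  have "x \<bullet> (diag_mat v *v ((mat 1 - L) *v x))
      = (\<Sum>s\<in>UNIV. v s * (x $ s)\<^sup>2) - (\<Sum>s\<in>UNIV. \<Sum>s'\<in>UNIV. v s * L $ s $ s' * (x $ s * x $ s'))"
    by (simp add: inner_vec_def diag_mat_vector_nth matrix_vector_mult_diff_rdistrib)
      (simp add: matrix_vector_mult_def algebra_simps power2_eq_square sum_subtractf sum_distrib_left)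
  \<comment> \<open>The bound \<open>2 a b \<le> a\<^sup>2 + b\<^sup>2\<close> splits the cross
    terms into two halves. The row half is at most half the sum of
    \<open>v s * (x $ s)\<^sup>2\<close>; by the equation for \<open>v\<close>, the column half is
    half of that same sum with \<open>v - d\<close> in place of \<open>v\<close>. What remains is
    half the form of \<open>d\<close>.\<close>
  moreover have "(\<Sum>s\<in>UNIV. \<Sum>s'\<in>UNIV. v s * L $ s $ s' * (x $ s * x $ s'))
      \<le> (\<Sum>s\<in>UNIV. \<Sum>s'\<in>UNIV. v s * L $ s $ s' * (((x $ s)\<^sup>2 + (x $ s')\<^sup>2) / 2))"
    using v(1) L(1) sum_squares_bound[of "x $ _" "x $ _"]
    by (intro sum_mono mult_left_mono mult_nonneg_nonneg) (auto simp: mult_ac)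
  moreover have "(\<Sum>s\<in>UNIV. \<Sum>s'\<in>UNIV. v s * L $ s $ s' * (((x $ s)\<^sup>2 + (x $ s')\<^sup>2) / 2))
      = (\<Sum>s\<in>UNIV. \<Sum>s'\<in>UNIV. v s * L $ s $ s' * (x $ s)\<^sup>2) / 2
        + (\<Sum>s\<in>UNIV. \<Sum>s'\<in>UNIV. v s * L $ s $ s' * (x $ s')\<^sup>2) / 2"
    by (simp add: sum_divide_distrib algebra_simps add_divide_distrib flip: sum.distrib)
  moreover have "(\<Sum>s\<in>UNIV. \<Sum>s'\<in>UNIV. v s * L $ s $ s' * (x $ s)\<^sup>2) \<le> (\<Sum>s\<in>UNIV. v s * (x $ s)\<^sup>2)"
  proof (intro sum_mono)
    fix s
    have "(\<Sum>s'\<in>UNIV. v s * L $ s $ s' * (x $ s)\<^sup>2) = (v s * (x $ s)\<^sup>2) * (\<Sum>s'\<in>UNIV. L $ s $ s')"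
      unfolding sum_distrib_left by (simp add: mult_ac)
    also have "\<dots> \<le> (v s * (x $ s)\<^sup>2) * 1"
      using L(2) v(1) by (intro mult_left_mono) auto
    finally show "(\<Sum>s'\<in>UNIV. v s * L $ s $ s' * (x $ s)\<^sup>2) \<le> v s * (x $ s)\<^sup>2"
      by simp
  qed
  moreover have "(\<Sum>s\<in>UNIV. \<Sum>s'\<in>UNIV. v s * L $ s $ s' * (x $ s')\<^sup>2)
      = (\<Sum>s\<in>UNIV. v s * (x $ s)\<^sup>2) - (\<Sum>s\<in>UNIV. d s * (x $ s)\<^sup>2)"
  proof -
    have "(\<Sum>s\<in>UNIV. \<Sum>s'\<in>UNIV. v s * L $ s $ s' * (x $ s')\<^sup>2)
        = (\<Sum>s'\<in>UNIV. (\<Sum>s\<in>UNIV. v s * L $ s $ s') * (x $ s')\<^sup>2)"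
      unfolding sum_distrib_right by (rule sum.swap)
    also have "\<dots> = (\<Sum>s'\<in>UNIV. (v s' - d s') * (x $ s')\<^sup>2)"
    proof (intro sum.cong refl)
      fix s'
      show "(\<Sum>s\<in>UNIV. v s * L $ s $ s') * (x $ s')\<^sup>2 = (v s' - d s') * (x $ s')\<^sup>2"
        using v(2)[of s'] by simp
    qed
    finally show ?thesis
      by (simp add: left_diff_distrib sum_subtractf)
  qed
  ultimately show ?thesis by linarith
qed

text \<open>Full column rank turns \<open>y \<noteq> 0\<close> into
  \<open>x = \<Phi> *v y \<noteq> 0\<close>. By Cauchy-Schwarz the perturbation changes the form at
  \<open>x\<close> by at most \<open>op_norm (D' - D) * op_norm B * (norm x)\<^sup>2\<close>, which
  stays below the margin \<open>c * (norm x)\<^sup>2\<close>. The threshold depends only on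
  \<open>c\<close> and \<open>B\<close>.\<close>

lemma pos_def_congruence_perturbation:
  fixes D B :: "real ^ 's ^ 's" and \<Phi> :: "real ^ 'k ^ 's"
  assumes rank: "rank \<Phi> = CARD('k)" and c: "0 < c"
    and D: "\<And>x. c * (norm x)\<^sup>2 \<le> x \<bullet> (D *v (B *v x))"
  shows "\<exists>\<eta>>0. \<forall>D'. op_norm (D' - D) < \<eta> \<longrightarrow> pos_def (transpose \<Phi> ** D' ** B ** \<Phi>)"
proof -
  \<comment> \<open>The added 1 keeps the denominator of the threshold \<open>c / ?N\<close>
    positive even when \<open>B\<close> is zero.\<close>
  let ?N = "op_norm B + 1"
  have N: "0 < ?N"
    using op_norm_nonneg[of B] by simp
  have "pos_def (transpose \<Phi> ** D' ** B ** \<Phi>)" if D': "op_norm (D' - D) < c / ?N" for D'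
    unfolding pos_def_def
  proof (intro allI impI)
    fix y :: "real ^ 'k" assume "y \<noteq> 0"
    define x where "x = \<Phi> *v y"
    have "inj ((*v) \<Phi>)"
      using rank by (simp add: full_rank_injective)
    then have x: "x \<noteq> 0"
      using \<open>y \<noteq> 0\<close> injD[of "(*v) \<Phi>" y 0] by (auto simp: x_def)
    have "\<bar>x \<bullet> ((D' - D) *v (B *v x))\<bar> \<le> norm x * norm ((D' - D) *v (B *v x))"
      by (rule Cauchy_Schwarz_ineq2)
    also have "\<dots> \<le> norm x * (op_norm (D' - D) * norm (B *v x))"
      by (intro mult_left_mono op_norm_bound norm_ge_zero)
    also have "\<dots> \<le> norm x * (op_norm (D' - D) * (op_norm B * norm x))"
      by (intro mult_left_mono op_norm_bound norm_ge_zero op_norm_nonneg)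
    also have "\<dots> = (op_norm (D' - D) * op_norm B) * (norm x)\<^sup>2"
      by (simp add: power2_eq_square)
    also have "\<dots> < c * (norm x)\<^sup>2"
    proof (intro mult_strict_right_mono)
      have "op_norm (D' - D) * op_norm B \<le> op_norm (D' - D) * ?N"
        by (intro mult_left_mono op_norm_nonneg) simp
      also have "\<dots> < c"
        using D' N by (simp add: pos_less_divide_eq)
      finally show "op_norm (D' - D) * op_norm B < c" .
    qed (use x in simp)
    also have "\<dots> \<le> x \<bullet> (D *v (B *v x))"
      by (rule D)
    finally have "0 < x \<bullet> (D *v (B *v x)) + x \<bullet> ((D' - D) *v (B *v x))"
      by linarith
    also have "\<dots> = x \<bullet> (D' *v (B *v x))"
      by (simp add: matrix_vector_mult_diff_rdistrib inner_diff_right)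
    also have "\<dots> = y \<bullet> ((transpose \<Phi> ** D' ** B ** \<Phi>) *v y)"
      by (simp add: x_def inner_commute[of y] dot_lmul_matrix flip: matrix_vector_mul_assoc)
        (rule inner_commute)
    finally show "0 < y \<bullet> ((transpose \<Phi> ** D' ** B ** \<Phi>) *v y)" .
  qed
  then show ?thesis
    using c N by (intro exI[of _ "c / ?N"]) auto
qed

section \<open>Stability under a small error of the trace model\<close>

theorem lemma2:
  fixes P :: "'s::finite \<Rightarrow> 'a::finite \<Rightarrow> 's pmf"
    and \<pi> \<mu> :: "'s \<Rightarrow> 'a pmf"
    and \<gamma> :: "'s \<Rightarrow> real"
    and n :: nat
    and d :: "'s pmf"
    and M :: "'w measure"
    and S :: "nat \<Rightarrow> 'w \<Rightarrow> 's"
    and A :: "nat \<Rightarrow> 'w \<Rightarrow> 'a"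
    and f :: "'s \<Rightarrow> real"
    and \<phi> :: "'s \<Rightarrow> real ^ 'k"
  defines "\<Phi> \<equiv> (\<chi> s. \<phi> s) :: real ^ 'k ^ 's"
  assumes discount: "\<And>s. 0 \<le> \<gamma> s \<and> \<gamma> s \<le> 1"
    and n: "n \<ge> 1"
    and ergodic: "ergodic_chain (policy_matrix P \<mu>)"
    and stationary: "stationary_dist (policy_matrix P \<mu>) d"
    and coverage: "\<And>s a. pmf (\<pi> s) a > 0 \<Longrightarrow> pmf (\<mu> s) a > 0"
    and trajectory: "mdp_trajectory M S A P \<mu>"
    and trace_limit: "\<And>s. (\<lambda>t. cond_expectation M (followon \<pi> \<mu> \<gamma> n S A t) (\<lambda>\<omega>. S t \<omega> = s))
                             \<longlonglongrightarrow> f s"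
    and full_column_rank: "rank \<Phi> = CARD('k)"
  shows "\<exists>\<eta>\<^sub>0>0. \<forall>f\<^sub>\<theta> :: 's \<Rightarrow> real.
           op_norm (diag_mat (\<lambda>s. pmf d s * f\<^sub>\<theta> s) - diag_mat (\<lambda>s. pmf d s * f s)) < \<eta>\<^sub>0 \<longrightarrow>
           pos_def (transpose \<Phi> ** diag_mat (\<lambda>s. pmf d s * f\<^sub>\<theta> s)
                    ** (mat 1 - mat_pow (policy_matrix P \<pi> ** diag_mat \<gamma>) n) ** \<Phi>)"
proof -
  interpret mdp_trajectory M S A P \<mu> by fact
  let ?Q = "policy_matrix P \<mu>"
  let ?K = "policy_matrix P \<pi> ** diag_mat \<gamma>"
  let ?L = "mat_pow ?K n"
  define dv where "dv = (\<chi> s. pmf d s)"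
  have irr: "irreducible_chain ?Q"
    using ergodic by (simp add: ergodic_chain_def)
  have dQ: "dv v* ?Q = dv"
    using stationary by (simp add: stationary_dist_def vec_eq_iff vector_matrix_mult_nth dv_def)
  have d_sum: "(\<Sum>s\<in>UNIV. dv $ s) = 1"
    by (simp add: dv_def sum_pmf_eq_1)
  \<comment> \<open>A probability distribution charges some state, and irreducibility spreads
    positivity from there to all states.\<close>
  obtain s\<^sub>0 where "s\<^sub>0 \<in> set_pmf d"
    using set_pmf_not_empty by fast
  then have "0 < dv $ s\<^sub>0"
    by (simp add: dv_def pmf_positive)
  then have d_pos: "0 < dv $ s" for s
    using irreducible_stationary_pos[OF irr policy_matrix_nonneg _ dQ] by (simp add: dv_def)
  have K_nonneg: "0 \<le> ?K $ s $ s'" for s s'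
    using discount by (simp add: diag_mat_mult_nth policy_matrix_nonneg)
  have K_row: "(\<Sum>s'\<in>UNIV. ?K $ s $ s') \<le> 1" for s
  proof -
    \<comment> \<open>The discount scales the columns by factors of at most 1, which makes the
      stochastic target matrix substochastic.\<close>
    have "(\<Sum>s'\<in>UNIV. ?K $ s $ s') \<le> (\<Sum>s'\<in>UNIV. policy_matrix P \<pi> $ s $ s')"
      unfolding diag_mat_mult_nth
      using discount by (intro sum_mono) (simp add: mult_left_le policy_matrix_nonneg)
    then show ?thesis
      by (simp add: policy_matrix_row_sum)
  qed
  have v_nonneg: "0 \<le> pmf d s * f s" for s
    using followon_limit_nonneg[OF _ trace_limit] discount by simp
  have v_eq: "pmf d s' * f s' = (\<Sum>s\<in>UNIV. pmf d s * f s * ?L $ s $ s') + pmf d s'" for s'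
    using followon_limit_equation[OF irr d_pos dQ d_sum _ n trace_limit, where s' = s'] coverage
    unfolding dv_def by simp
  \<comment> \<open>The smallest stationary probability bounds the form of \<open>d\<close> below;
    the factor one half is the one lost in \<open>emphasis_quadratic_form\<close>.\<close>
  define c where "c = Min (range (pmf d)) / 2"
  have "Min (range (pmf d)) \<in> range (pmf d)"
    by (rule Min_in) auto
  then have c: "0 < c"
    using d_pos by (auto simp: c_def dv_def)
  have "c * (norm x)\<^sup>2 \<le> x \<bullet> (diag_mat (\<lambda>s. pmf d s * f s) *v ((mat 1 - ?L) *v x))" for x
  proof -
    have "c * (norm x)\<^sup>2 = (\<Sum>s\<in>UNIV. Min (range (pmf d)) * (x $ s)\<^sup>2) / 2"
      unfolding power2_norm_eq_inner inner_vec_def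
      by (simp add: c_def power2_eq_square flip: sum_distrib_left)
    also have "\<dots> \<le> (\<Sum>s\<in>UNIV. pmf d s * (x $ s)\<^sup>2) / 2"
      by (intro divide_right_mono sum_mono mult_right_mono Min_le) auto
    also have "\<dots> \<le> x \<bullet> (diag_mat (\<lambda>s. pmf d s * f s) *v ((mat 1 - ?L) *v x))"
      by (intro emphasis_quadratic_form mat_pow_nonneg mat_pow_row_sum_le_1 K_nonneg K_row v_nonneg v_eq)
    finally show ?thesis .
  qed
  from pos_def_congruence_perturbation[OF full_column_rank c this]
  show ?thesis by blast
qed

end
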